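(* Let $\mathcal C_{\mathcal T}\subset\mathbb Z_{\ge 0}^{12}$ be the Knutson--Tao--Goncharov--Shen cone of the triangulated ideal square, let $C_{\mathcal T}=\mathrm{span}_{\mathbb R_{\ge0}}(\mathcal C_{\mathcal T})\subset\mathbb R_{\ge 0}^{12}$ be its completion, and for $i=1,\dots,42$ let $C^i_{\mathcal T}=\mathrm{span}_{\mathbb R_{\ge0}}\{h_j: j\in\{1,\dots,8\}\cup I_i\}\subset C_{\mathcal T}$ (vectors $h_j$ and index sets $I_i\subset\{9,\dots,22\}$ as in the context). Then: (I) $C_{\mathcal T}$ is $12$-dimensional, i.e. a full cone. (II) The subcones $C^i_{\mathcal T}$ are full sectors forming a sector decomposition $\{C^i_{\mathcal T}\}_{i=1,\dots,42}$ of $C_{\mathcal T}$. (III) The intersection $C^i_{\mathcal T}\cap C^\ell_{\mathcal T}$ is a wall if and only if $I_i\cap I_\ell$ has $3$ elements. In this case $$C^i_{\mathcal T}\cap C^\ell_{\mathcal T}=\mathrm{span}_{\mathbb R_{\ge0}}\{h_j:\ j\in\{1,\dots,8\}\cup(I_i\cap I_\ell)\}.$$ Moreover, for each $i\in\{1,\dots,42\}$ and each $j\in I_i$ there is a unique index $i^*=i^*(i,j)\in\{1,\dots,42\}$ such that $I_i\cap I_{i^*}=I_i-\{j\}$; that is, $I_{i^*}$ is obtained from $I_i$ by replacing $j$ by some element $j^*\neq j$. In particular, each sector $C^i_{\mathcal T}$ has $4$ walls.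
   Context: **Cones.** A real cone is the set of $\mathbb R_{\ge0}$-combinations of finitely many vectors in $\mathbb R^n$; its rank is the minimal size of a generating set and its dimension is the dimension of its linear span; it is a sector if rank equals dimension, and full if its dimension is $n$. A sector decomposition of a full cone $C\subset\mathbb R^n$ is a finite collection of full sectors $C_i\subset C$ with $\bigcup_i C_i=C$ and with $C_i\cap C_j$ having empty interior in $\mathbb R^n$ for $i\neq j$. For two full cones in $\mathbb R^n$, their intersection is a wall if it is a cone of dimension $n-1$. **The KTGS cone of the square.** Write points of $\mathbb R^{12}$ as $v=(x_1,\dots,x_8,y_1,\dots,y_4)$. The $18$ rhombus numbers $\beta_1,\dots,\beta_{18}$ of $v$ are given by $3\beta_1=x_1+x_8-y_1$, $3\beta_2=x_2+y_1-y_2-x_1$, $3\beta_3=y_1+x_7-y_4-x_8$, $3\beta_4=x_2+y_2-y_1$, $3\beta_5=y_4+y_1-x_7-y_2$, $3\beta_6=x_1+y_1-x_8-x_2$, $3\beta_7=x_7+y_4-y_1$, $3\beta_8=x_8+y_1-x_1-x_7$, $3\beta_9=y_1+y_2-x_2-y_4$, $3\beta_{10}=x_4+x_5-y_3$, $3\beta_{11}=x_6+y_3-y_4-x_5$, $3\beta_{12}=x_3+y_3-y_2-x_4$, $3\beta_{13}=x_3+y_2-y_3$, $3\beta_{14}=x_4+y_3-x_5-x_3$, $3\beta_{15}=y_4+y_3-x_6-y_2$, $3\beta_{16}=x_6+y_4-y_3$, $3\beta_{17}=y_2+y_3-x_3-y_4$, $3\beta_{18}=x_5+y_3-x_4-x_6$.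 The KTGS cone is $\mathcal C_{\mathcal T}=\{v\in\mathbb Z^{12}:\beta_i(v)\in\mathbb Z_{\ge0}\text{ for }i=1,\dots,18\}$; it is contained in $\mathbb Z_{\ge0}^{12}$ and finitely generated as a monoid. **Vectors.** (These are the tropical coordinates of the $22$ irreducible reduced webs in the square; $h_1,\dots,h_8$ correspond to the corner arcs, and $\{h_j\}_{j\in I_i}$ to the four webs forming the "topological type" $\mathcal Q_i$ of $C^i_{\mathcal T}$.) $h_1=(2,1,0,0,0,0,1,2,1,0,0,0)$, $h_2=(1,2,0,0,0,0,2,1,2,0,0,0)$, $h_3=(1,2,2,1,0,0,0,0,1,2,1,1)$, $h_4=(2,1,1,2,0,0,0,0,2,1,2,2)$, $h_5=(0,0,0,0,1,2,2,1,1,1,1,2)$, $h_6=(0,0,0,0,2,1,1,2,2,2,2,1)$, $h_7=(0,0,1,2,2,1,0,0,0,0,1,0)$, $h_8=(0,0,2,1,1,2,0,0,0,0,2,0)$, $h_9=(2,1,2,1,0,0,2,1,3,2,1,1)$, $h_{10}=(2,1,0,0,2,1,2,1,3,2,2,1)$, $h_{11}=(1,2,1,2,0,0,1,2,3,1,2,2)$, $h_{12}=(1,2,0,0,1,2,1,2,3,1,1,2)$, $h_{13}=(2,1,2,1,2,1,0,0,2,1,3,2)$, $h_{14}=(0,0,1,2,1,2,1,2,2,2,3,1)$, $h_{15}=(1,2,1,2,1,2,0,0,1,2,3,1)$, $h_{16}=(0,0,2,1,2,1,2,1,1,1,3,2)$, $h_{17}=(2,1,1,2,1,2,2,1,3,2,3,1)$,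 $h_{18}=(1,2,2,1,2,1,1,2,3,1,3,2)$, $h_{19}=(2,1,0,0,1,2,0,0,2,1,1,2)$, $h_{20}=(1,2,0,0,2,1,0,0,1,2,2,1)$, $h_{21}=(0,0,1,2,0,0,2,1,1,1,2,2)$, $h_{22}=(0,0,2,1,0,0,1,2,2,2,1,1)$. **Index sets.** $I_1=\{11,16,20,21\}$, $I_2=\{10,16,20,21\}$, $I_3=\{11,15,20,21\}$, $I_4=\{10,15,20,21\}$, $I_5=\{11,16,18,20\}$, $I_6=\{12,13,18,20\}$, $I_7=\{11,16,18,22\}$, $I_8=\{12,13,18,22\}$, $I_9=\{9,14,19,22\}$, $I_{10}=\{12,14,19,22\}$, $I_{11}=\{9,13,19,22\}$, $I_{12}=\{12,13,19,22\}$, $I_{13}=\{9,14,17,19\}$, $I_{14}=\{10,15,17,19\}$, $I_{15}=\{9,14,17,21\}$, $I_{16}=\{10,15,17,21\}$, $I_{17}=\{9,10,16,21\}$, $I_{18}=\{11,14,15,21\}$, $I_{19}=\{11,12,14,22\}$, $I_{20}=\{9,13,16,22\}$, $I_{21}=\{9,16,21,22\}$, $I_{22}=\{9,14,21,22\}$, $I_{23}=\{11,16,21,22\}$, $I_{24}=\{11,14,21,22\}$, $I_{25}=\{9,10,13,19\}$, $I_{26}=\{12,14,15,19\}$, $I_{27}=\{11,12,15,20\}$, $I_{28}=\{10,13,16,20\}$, $I_{29}=\{10,13,19,20\}$, $I_{30}=\{10,15,19,20\}$, $I_{31}=\{12,13,19,20\}$, $I_{32}=\{12,15,19,20\}$,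 $I_{33}=\{9,10,13,16\}$, $I_{34}=\{11,12,14,15\}$, $I_{35}=\{11,12,18,20\}$, $I_{36}=\{13,16,18,20\}$, $I_{37}=\{11,12,18,22\}$, $I_{38}=\{13,16,18,22\}$, $I_{39}=\{9,10,17,19\}$, $I_{40}=\{14,15,17,19\}$, $I_{41}=\{9,10,17,21\}$, $I_{42}=\{14,15,17,21\}$. *)

theory Defs
  imports "HOL-Analysis.Analysis"
begin

section \<open>Real cones in a Euclidean space\<close>

text \<open>The \<open>\<real>\<close>-nonnegative span of an arbitrary (possibly infinite) set: all finite
  combinations with nonnegative coefficients. In particular the span of the empty set is \<open>{0}\<close>.\<close>

definition nonneg_span :: "'a::real_vector set \<Rightarrow> 'a set" where
  "nonneg_span S =
     {\<Sum>v\<in>T. c v *\<^sub>R v | T c. finite T \<and> T \<subseteq> S \<and> (\<forall>v\<in>T. 0 \<le> c v)}"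

lemma nonneg_span_eq_convex_cone_hull: "nonneg_span S = convex_cone hull S"
proof (rule hull_unique[symmetric])
  show "S \<subseteq> nonneg_span S"
  proof
    fix x assume "x \<in> S"
    then show "x \<in> nonneg_span S"
      unfolding nonneg_span_def by (auto intro!: exI[of _ "{x}"] exI[of _ "\<lambda>_. 1"])
  qed
  have zero: "0 \<in> nonneg_span S"
    unfolding nonneg_span_def by (auto intro!: exI[of _ "{}"])
  have add: "x + y \<in> nonneg_span S" if "x \<in> nonneg_span S" "y \<in> nonneg_span S" for x y
  proof -
    obtain T c where T: "finite T" "T \<subseteq> S" "\<forall>v\<in>T. 0 \<le> c v" "x = (\<Sum>v\<in>T. c v *\<^sub>R v)"
      using \<open>x \<in> nonneg_span S\<close> unfolding nonneg_span_def by blast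
    obtain U d where U: "finite U" "U \<subseteq> S" "\<forall>v\<in>U. 0 \<le> d v" "y = (\<Sum>v\<in>U. d v *\<^sub>R v)"
      using \<open>y \<in> nonneg_span S\<close> unfolding nonneg_span_def by blast
    define e where "e v = (if v \<in> T then c v else 0) + (if v \<in> U then d v else 0)" for v
    have "x = (\<Sum>v\<in>T \<union> U. (if v \<in> T then c v else 0) *\<^sub>R v)"
      unfolding T(4) using T(1) U(1) by (intro sum.mono_neutral_cong_left) auto
    moreover have "y = (\<Sum>v\<in>T \<union> U. (if v \<in> U then d v else 0) *\<^sub>R v)"
      unfolding U(4) using T(1) U(1) by (intro sum.mono_neutral_cong_left) auto
    ultimately have "x + y = (\<Sum>v\<in>T \<union> U. e v *\<^sub>R v)"
      by (simp add: e_def scaleR_add_left sum.distrib)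
    moreover have "\<forall>v\<in>T \<union> U. 0 \<le> e v"
      using T(3) U(3) by (auto simp: e_def)
    ultimately show ?thesis
      unfolding nonneg_span_def using T(1,2) U(1,2) by blast
  qed
  have scale: "a *\<^sub>R x \<in> nonneg_span S" if "x \<in> nonneg_span S" "0 \<le> a" for x a
  proof -
    obtain T c where T: "finite T" "T \<subseteq> S" "\<forall>v\<in>T. 0 \<le> c v" "x = (\<Sum>v\<in>T. c v *\<^sub>R v)"
      using \<open>x \<in> nonneg_span S\<close> unfolding nonneg_span_def by blast
    have "a *\<^sub>R x = (\<Sum>v\<in>T. (a * c v) *\<^sub>R v)"
      by (simp add: T(4) scaleR_sum_right)
    moreover have "\<forall>v\<in>T. 0 \<le> a * c v"
      using T(3) \<open>0 \<le> a\<close> by simp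
    ultimately show ?thesis
      unfolding nonneg_span_def using T(1,2) by (intro CollectI exI[of _ T] exI[of _ "\<lambda>v. a * c v"]) simp
  qed
  show "convex_cone (nonneg_span S)"
    unfolding convex_cone_iff using zero add scale by blast
next
  fix K assume K: "S \<subseteq> K" "convex_cone K"
  show "nonneg_span S \<subseteq> K"
  proof
    fix x assume "x \<in> nonneg_span S"
    then obtain T c where T: "finite T" "T \<subseteq> S" "\<forall>v\<in>T. 0 \<le> c v" "x = (\<Sum>v\<in>T. c v *\<^sub>R v)"
      unfolding nonneg_span_def by blast
    from T(1-3) have "(\<Sum>v\<in>T. c v *\<^sub>R v) \<in> K"
      using K by (induction T rule: finite_induct) (auto simp: convex_cone_iff)
    then show "x \<in> K" by (simp add: T(4))
  qed
qed

definition real_cone :: "'a::euclidean_space set \<Rightarrow> bool" where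
  "real_cone C \<longleftrightarrow> (\<exists>S. finite S \<and> C = nonneg_span S)"

text \<open>The \<open>LEAST\<close> is unspecified unless \<open>C\<close> is a real cone.\<close>

definition cone_rank :: "'a::euclidean_space set \<Rightarrow> nat" where
  "cone_rank C = (LEAST k. \<exists>S. finite S \<and> card S = k \<and> C = nonneg_span S)"

text \<open>The dimension of a cone, i.e. of its linear span, is the library's \<^const>\<open>dim\<close>.\<close>

definition sector :: "'a::euclidean_space set \<Rightarrow> bool" where
  "sector C \<longleftrightarrow> real_cone C \<and> cone_rank C = dim C"

definition full_cone :: "'a::euclidean_space set \<Rightarrow> bool" where
  "full_cone C \<longleftrightarrow> real_cone C \<and> dim C = DIM('a)"

text \<open>A decomposition is given as an indexed family, so that disjointness of interiors is
  required for distinct indices.\<close>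

definition sector_decomposition ::
    "'i set \<Rightarrow> ('i \<Rightarrow> 'a::euclidean_space set) \<Rightarrow> 'a set \<Rightarrow> bool" where
  "sector_decomposition A D C \<longleftrightarrow>
     full_cone C \<and> finite A \<and>
     (\<forall>i\<in>A. sector (D i) \<and> full_cone (D i) \<and> D i \<subseteq> C) \<and>
     (\<Union>i\<in>A. D i) = C \<and>
     (\<forall>i\<in>A. \<forall>j\<in>A. i \<noteq> j \<longrightarrow> interior (D i \<inter> D j) = {})"

definition intersect_in_wall :: "'a::euclidean_space set \<Rightarrow> 'a set \<Rightarrow> bool" where
  "intersect_in_wall C D \<longleftrightarrow>
     full_cone C \<and> full_cone D \<and> real_cone (C \<inter> D) \<and> dim (C \<inter> D) = DIM('a) - 1"


section \<open>The KTGS cone of the square\<close>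

text \<open>A point \<open>(x\<^sub>1,\<dots>,x\<^sub>8,y\<^sub>1,\<dots>,y\<^sub>4)\<close> is a vector \<open>v\<close> with \<open>x\<^sub>i = v $ i\<close> and
  \<open>y\<^sub>j = v $ (8 + j)\<close>. The indices live in the numeral type \<open>12\<close>, where arithmetic is modulo \<open>12\<close>;
  the index of \<open>y\<^sub>4\<close> is \<open>12 = 0\<close>, and \<open>1, \<dots>, 12\<close> are the twelve distinct elements. This is also
  the indexing used by the library's \<^const>\<open>vector\<close>.

  The list below consists of \<open>3 \<beta>\<^sub>1, \<dots>, 3 \<beta>\<^sub>1\<^sub>8\<close>.\<close>

definition rhombus_number :: "nat \<Rightarrow> real^12 \<Rightarrow> real" where
  "rhombus_number i v =
    (let x = (\<lambda>k::12. v $ k); y = (\<lambda>k::12. v $ (8 + k)) in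
     [x 1 + x 8 - y 1, x 2 + y 1 - y 2 - x 1, y 1 + x 7 - y 4 - x 8,
      x 2 + y 2 - y 1, y 4 + y 1 - x 7 - y 2, x 1 + y 1 - x 8 - x 2,
      x 7 + y 4 - y 1, x 8 + y 1 - x 1 - x 7, y 1 + y 2 - x 2 - y 4,
      x 4 + x 5 - y 3, x 6 + y 3 - y 4 - x 5, x 3 + y 3 - y 2 - x 4,
      x 3 + y 2 - y 3, x 4 + y 3 - x 5 - x 3, y 4 + y 3 - x 6 - y 2,
      x 6 + y 4 - y 3, y 2 + y 3 - x 3 - y 4, x 5 + y 3 - x 4 - x 6] ! (i - 1) / 3)"

text \<open>\<open>\<int>\<close> and \<open>\<nat>\<close> are the sets of integers and of nonnegative integers inside \<open>\<real>\<close>.\<close>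

definition KTGS_cone :: "(real^12) set" where
  "KTGS_cone = {v. (\<forall>k. v $ k \<in> \<int>) \<and> (\<forall>i\<in>{1..18}. rhombus_number i v \<in> \<nat>)}"

definition KTGS_completion :: "(real^12) set" where
  "KTGS_completion = nonneg_span KTGS_cone"

definition web_vec :: "nat \<Rightarrow> real^12" where
  "web_vec j = vector (
     [[2,1,0,0,0,0,1,2,1,0,0,0],
      [1,2,0,0,0,0,2,1,2,0,0,0],
      [1,2,2,1,0,0,0,0,1,2,1,1],
      [2,1,1,2,0,0,0,0,2,1,2,2],
      [0,0,0,0,1,2,2,1,1,1,1,2],
      [0,0,0,0,2,1,1,2,2,2,2,1],
      [0,0,1,2,2,1,0,0,0,0,1,0],
      [0,0,2,1,1,2,0,0,0,0,2,0],
      [2,1,2,1,0,0,2,1,3,2,1,1],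
      [2,1,0,0,2,1,2,1,3,2,2,1],
      [1,2,1,2,0,0,1,2,3,1,2,2],
      [1,2,0,0,1,2,1,2,3,1,1,2],
      [2,1,2,1,2,1,0,0,2,1,3,2],
      [0,0,1,2,1,2,1,2,2,2,3,1],
      [1,2,1,2,1,2,0,0,1,2,3,1],
      [0,0,2,1,2,1,2,1,1,1,3,2],
      [2,1,1,2,1,2,2,1,3,2,3,1],
      [1,2,2,1,2,1,1,2,3,1,3,2],
      [2,1,0,0,1,2,0,0,2,1,1,2],
      [1,2,0,0,2,1,0,0,1,2,2,1],
      [0,0,1,2,0,0,2,1,1,1,2,2],
      [0,0,2,1,0,0,1,2,2,2,1,1]] ! (j - 1))"

definition web_index :: "nat \<Rightarrow> nat set" where
  "web_index i =
     [{11,16,20,21}, {10,16,20,21}, {11,15,20,21}, {10,15,20,21}, {11,16,18,20}, {12,13,18,20},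
      {11,16,18,22}, {12,13,18,22}, {9,14,19,22}, {12,14,19,22}, {9,13,19,22}, {12,13,19,22},
      {9,14,17,19}, {10,15,17,19}, {9,14,17,21}, {10,15,17,21}, {9,10,16,21}, {11,14,15,21},
      {11,12,14,22}, {9,13,16,22}, {9,16,21,22}, {9,14,21,22}, {11,16,21,22}, {11,14,21,22},
      {9,10,13,19}, {12,14,15,19}, {11,12,15,20}, {10,13,16,20}, {10,13,19,20}, {10,15,19,20},
      {12,13,19,20}, {12,15,19,20}, {9,10,13,16}, {11,12,14,15}, {11,12,18,20}, {13,16,18,20},
      {11,12,18,22}, {13,16,18,22}, {9,10,17,19}, {14,15,17,19}, {9,10,17,21}, {14,15,17,21}] ! (i - 1)"

definition KTGS_sector :: "nat \<Rightarrow> (real^12) set" where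
  "KTGS_sector i = nonneg_span (web_vec ` ({1..8} \<union> web_index i))"

end

theory Submission
  imports Defs
begin

text \<open>
  Every point \<open>v\<close> of the polyhedral cone \<open>{\<beta>\<^sub>i \<ge> 0}\<close> is a nonnegative combination of the \<open>h\<^sub>j\<close> in which
  no two ``crossing'' vectors (two of \<open>h\<^sub>9, \<dots>, h\<^sub>2\<^sub>2\<close> that lie in no common \<open>I\<^sub>i\<close>) both occur, and such
  a combination is unique: its coefficients are explicit piecewise linear functions of \<open>v\<close>. Since a
  set without crossing pairs lies in some \<open>I\<^sub>i\<close>, existence shows that the sectors cover the cone, and
  uniqueness shows that the generators of a sector are independent and that any two faces of sectors
  meet in the face spanned by their common generators. Dimensions and walls are then counted by the
  index sets alone.
\<close>

section \<open>Index lists, crossing pairs and candidate coordinates\<close>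

text \<open>Lists instead of sets let \<open>code_simp\<close> evaluate the finite checks on the 42
  index sets.\<close>

definition web_index_lists :: "nat list list" where
  "web_index_lists =
     [[11,16,20,21], [10,16,20,21], [11,15,20,21], [10,15,20,21], [11,16,18,20], [12,13,18,20],
      [11,16,18,22], [12,13,18,22], [9,14,19,22], [12,14,19,22], [9,13,19,22], [12,13,19,22],
      [9,14,17,19], [10,15,17,19], [9,14,17,21], [10,15,17,21], [9,10,16,21], [11,14,15,21],
      [11,12,14,22], [9,13,16,22], [9,16,21,22], [9,14,21,22], [11,16,21,22], [11,14,21,22],
      [9,10,13,19], [12,14,15,19], [11,12,15,20], [10,13,16,20], [10,13,19,20], [10,15,19,20],
      [12,13,19,20], [12,15,19,20], [9,10,13,16], [11,12,14,15], [11,12,18,20], [13,16,18,20],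
      [11,12,18,22], [13,16,18,22], [9,10,17,19], [14,15,17,19], [9,10,17,21], [14,15,17,21]]"

text \<open>The pairs of indices that lie in no common \<open>I\<^sub>i\<close>.\<close>

definition crossing_pairs :: "(nat \<times> nat) list" where
  "crossing_pairs =
     [(9,11), (9,12), (9,15), (9,18), (9,20), (10,11), (10,12), (10,14), (10,18), (10,22),
      (11,13), (11,17), (11,19), (12,16), (12,17), (12,21), (13,14), (13,15), (13,17), (13,21),
      (14,16), (14,18), (14,20), (15,16), (15,18), (15,22), (16,17), (16,19), (17,18), (17,20),
      (17,22), (18,19), (18,21), (19,21), (20,22)]"

text \<open>The numbers \<open>p, q, c, d\<close> span the linear forms that vanish on \<open>h\<^sub>1, \<dots>, h\<^sub>8\<close>. For \<open>j \<ge> 9\<close> the inner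
  minimum runs over the distinct linear forms giving the coefficient of \<open>h\<^sub>j\<close> in the bases
  \<open>{h\<^sub>k | k \<in> {1..8} \<union> I\<^sub>i}\<close> with \<open>j \<in> I\<^sub>i\<close>.\<close>

definition web_coord :: "real^12 \<Rightarrow> nat \<Rightarrow> real" where
  "web_coord v j =
    (let b = (\<lambda>i. rhombus_number i v);
         p = b 2 - b 3; q = b 11 - b 12; c = b 4 - b 13; d = b 7 - b 16 in
     [b 1,
      min (b 2) (b 3),
      min (b 4) (b 13),
      min (min (b 5) (b 6)) (min (b 14) (b 15)),
      min (b 7) (b 16),
      min (min (b 8) (b 9)) (min (b 17) (b 18)),
      b 10,
      min (b 11) (b 12),
      max 0 (min (-p) (-c)),
      max 0 (min (-p - q + c) (min (-p) (-p + c))),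
      max 0 (min p (min (p + d) (p + q + d))),
      max 0 (min (-d) p),
      max 0 (min (-p - q - d) (min (-q - d) (-q))),
      max 0 (min (q - c) (min q (p + q - c))),
      max 0 (min c q),
      max 0 (min (-q) d),
      max 0 (min (-p) (min (-p + c) (min (q - c) q))),
      max 0 (min (-q - d) (min (-q) (min p (p + d)))),
      max 0 (min (-p - d) (-d)),
      max 0 (min (-q + c) c),
      max 0 (min d (q + d)),
      max 0 (min (-c) (p - c))] ! (j - 1))"

definition web_comb :: "(nat \<Rightarrow> real) \<Rightarrow> real^12" where
  "web_comb a = (\<Sum>j\<in>{1..22}. a j *\<^sub>R web_vec j)"

definition admissible :: "(nat \<Rightarrow> real) \<Rightarrow> bool" where
  "admissible a \<longleftrightarrow> (\<forall>j\<in>{1..22}. 0 \<le> a j) \<and> (\<forall>(j, k)\<in>set crossing_pairs. a j = 0 \<or> a k = 0)"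

section \<open>Vectors, sums and rhombus numbers written out\<close>

lemma forall_12: "(\<forall>k::12. P k) \<longleftrightarrow>
    P 1 \<and> P 2 \<and> P 3 \<and> P 4 \<and> P 5 \<and> P 6 \<and> P 7 \<and> P 8 \<and> P 9 \<and> P 10 \<and> P 11 \<and> P 12"
proof -
  have "k = 1 \<or> k = 2 \<or> k = 3 \<or> k = 4 \<or> k = 5 \<or> k = 6 \<or> k = 7 \<or> k = 8 \<or> k = 9 \<or> k = 10
      \<or> k = 11 \<or> k = 12" for k :: 12
  proof (induct k)
    case (of_int z)
    \<comment> \<open>The representatives run from 0 to 11, and 0 stands for the index 12.\<close>
    then have "z = 0 \<or> z = 1 \<or> z = 2 \<or> z = 3 \<or> z = 4 \<or> z = 5 \<or> z = 6 \<or> z = 7 \<or> z = 8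
        \<or> z = 9 \<or> z = 10 \<or> z = 11"
      by simp presburger
    then show ?case by auto
  qed
  then show ?thesis by metis
qed

lemma vector_12:
  fixes x1 x2 x3 x4 x5 x6 x7 x8 x9 x10 x11 x12 :: real
  defines "v \<equiv> (vector [x1,x2,x3,x4,x5,x6,x7,x8,x9,x10,x11,x12] :: real^12)"
  shows "v $ 1 = x1"
    "v $ 2 = x2"
    "v $ 3 = x3"
    "v $ 4 = x4"
    "v $ 5 = x5"
    "v $ 6 = x6"
    "v $ 7 = x7"
    "v $ 8 = x8"
    "v $ 9 = x9"
    "v $ 10 = x10"
    "v $ 11 = x11"
    "v $ 12 = x12"
  unfolding v_def vector_def by simp_all

lemma rhombus_number_simps:
  "rhombus_number 1 v = (v$1 + v$8 - v$9) / 3"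
  "rhombus_number 2 v = (v$2 + v$9 - v$1 - v$10) / 3"
  "rhombus_number 3 v = (v$7 + v$9 - v$8 - v$12) / 3"
  "rhombus_number 4 v = (v$2 + v$10 - v$9) / 3"
  "rhombus_number 5 v = (v$9 + v$12 - v$7 - v$10) / 3"
  "rhombus_number 6 v = (v$1 + v$9 - v$2 - v$8) / 3"
  "rhombus_number 7 v = (v$7 + v$12 - v$9) / 3"
  "rhombus_number 8 v = (v$8 + v$9 - v$1 - v$7) / 3"
  "rhombus_number 9 v = (v$9 + v$10 - v$2 - v$12) / 3"
  "rhombus_number 10 v = (v$4 + v$5 - v$11) / 3"
  "rhombus_number 11 v = (v$6 + v$11 - v$5 - v$12) / 3"
  "rhombus_number 12 v = (v$3 + v$11 - v$4 - v$10) / 3"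
  "rhombus_number 13 v = (v$3 + v$10 - v$11) / 3"
  "rhombus_number 14 v = (v$4 + v$11 - v$3 - v$5) / 3"
  "rhombus_number 15 v = (v$11 + v$12 - v$6 - v$10) / 3"
  "rhombus_number 16 v = (v$6 + v$12 - v$11) / 3"
  "rhombus_number 17 v = (v$10 + v$11 - v$3 - v$12) / 3"
  "rhombus_number 18 v = (v$5 + v$11 - v$4 - v$6) / 3"
  by (simp_all add: rhombus_number_def Let_def)

lemma sum_1_22: "(\<Sum>j\<in>{1..22}. f j) =
    f 1 + f 2 + f 3 + f 4 + f 5 + f 6 + f 7 + f 8 + f 9 + f 10 + f 11 +
    f 12 + f 13 + f 14 + f 15 + f 16 + f 17 + f 18 + f 19 + f 20 + f 21 + f 22"
  for f :: "nat \<Rightarrow> 'a::comm_monoid_add"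
  by (simp add: numeral_eq_Suc sum.atLeast_Suc_atMost add.assoc)

lemma web_vec_simps:
  "web_vec 1 = vector [2,1,0,0,0,0,1,2,1,0,0,0]"
  "web_vec 2 = vector [1,2,0,0,0,0,2,1,2,0,0,0]"
  "web_vec 3 = vector [1,2,2,1,0,0,0,0,1,2,1,1]"
  "web_vec 4 = vector [2,1,1,2,0,0,0,0,2,1,2,2]"
  "web_vec 5 = vector [0,0,0,0,1,2,2,1,1,1,1,2]"
  "web_vec 6 = vector [0,0,0,0,2,1,1,2,2,2,2,1]"
  "web_vec 7 = vector [0,0,1,2,2,1,0,0,0,0,1,0]"
  "web_vec 8 = vector [0,0,2,1,1,2,0,0,0,0,2,0]"
  "web_vec 9 = vector [2,1,2,1,0,0,2,1,3,2,1,1]"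
  "web_vec 10 = vector [2,1,0,0,2,1,2,1,3,2,2,1]"
  "web_vec 11 = vector [1,2,1,2,0,0,1,2,3,1,2,2]"
  "web_vec 12 = vector [1,2,0,0,1,2,1,2,3,1,1,2]"
  "web_vec 13 = vector [2,1,2,1,2,1,0,0,2,1,3,2]"
  "web_vec 14 = vector [0,0,1,2,1,2,1,2,2,2,3,1]"
  "web_vec 15 = vector [1,2,1,2,1,2,0,0,1,2,3,1]"
  "web_vec 16 = vector [0,0,2,1,2,1,2,1,1,1,3,2]"
  "web_vec 17 = vector [2,1,1,2,1,2,2,1,3,2,3,1]"
  "web_vec 18 = vector [1,2,2,1,2,1,1,2,3,1,3,2]"
  "web_vec 19 = vector [2,1,0,0,1,2,0,0,2,1,1,2]"
  "web_vec 20 = vector [1,2,0,0,2,1,0,0,1,2,2,1]"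
  "web_vec 21 = vector [0,0,1,2,0,0,2,1,1,1,2,2]"
  "web_vec 22 = vector [0,0,2,1,0,0,1,2,2,2,1,1]"
  by (simp_all add: web_vec_def)

text \<open>The 0/1 incidence table of the 18 rhombus numbers against the 22 vectors. Every later
  use of the entries of the vectors, apart from their integrality, goes through this table.\<close>

lemma rhombus_number_web_comb:
  "rhombus_number 1 (web_comb a) = a 1"
  "rhombus_number 2 (web_comb a) = a 2 + a 11 + a 12 + a 18"
  "rhombus_number 3 (web_comb a) = a 2 + a 9 + a 10 + a 17"
  "rhombus_number 4 (web_comb a) = a 3 + a 15 + a 20"
  "rhombus_number 5 (web_comb a) = a 4 + a 11 + a 12 + a 13 + a 18 + a 19"
  "rhombus_number 6 (web_comb a) = a 4 + a 9 + a 10 + a 13 + a 17 + a 19"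
  "rhombus_number 7 (web_comb a) = a 5 + a 16 + a 21"
  "rhombus_number 8 (web_comb a) = a 6 + a 11 + a 12 + a 14 + a 18 + a 22"
  "rhombus_number 9 (web_comb a) = a 6 + a 9 + a 10 + a 14 + a 17 + a 22"
  "rhombus_number 10 (web_comb a) = a 7"
  "rhombus_number 11 (web_comb a) = a 8 + a 14 + a 15 + a 17"
  "rhombus_number 12 (web_comb a) = a 8 + a 13 + a 16 + a 18"
  "rhombus_number 13 (web_comb a) = a 3 + a 9 + a 22"
  "rhombus_number 14 (web_comb a) = a 4 + a 11 + a 14 + a 15 + a 17 + a 21"
  "rhombus_number 15 (web_comb a) = a 4 + a 11 + a 13 + a 16 + a 18 + a 21"
  "rhombus_number 16 (web_comb a) = a 5 + a 12 + a 19"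
  "rhombus_number 17 (web_comb a) = a 6 + a 10 + a 14 + a 15 + a 17 + a 20"
  "rhombus_number 18 (web_comb a) = a 6 + a 10 + a 13 + a 16 + a 18 + a 20"
  unfolding web_comb_def sum_1_22
  by (simp_all add: rhombus_number_simps web_vec_simps vector_12 del: One_nat_def)

lemma ball_1_18: "(\<forall>i\<in>{1..18::nat}. P i) \<longleftrightarrow>
    P 1 \<and> P 2 \<and> P 3 \<and> P 4 \<and> P 5 \<and> P 6 \<and> P 7 \<and> P 8 \<and>
    P 9 \<and> P 10 \<and> P 11 \<and> P 12 \<and> P 13 \<and> P 14 \<and> P 15 \<and>
    P 16 \<and> P 17 \<and> P 18"
proof -
  have "{1..18::nat} = {1,2,3,4,5,6,7,8,9,10,11,12,13,14,15,16,17,18}" by code_simp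
  then show ?thesis by (simp del: One_nat_def)
qed

lemma ball_1_22: "(\<forall>i\<in>{1..22::nat}. P i) \<longleftrightarrow>
    P 1 \<and> P 2 \<and> P 3 \<and> P 4 \<and> P 5 \<and> P 6 \<and> P 7 \<and> P 8 \<and>
    P 9 \<and> P 10 \<and> P 11 \<and> P 12 \<and> P 13 \<and> P 14 \<and> P 15 \<and>
    P 16 \<and> P 17 \<and> P 18 \<and> P 19 \<and> P 20 \<and> P 21 \<and> P 22"
proof -
  have "{1..22::nat} = {1,2,3,4,5,6,7,8,9,10,11,12,13,14,15,16,17,18,19,20,21,22}" by code_simp
  then show ?thesis by (simp del: One_nat_def)
qed

text \<open>The 18 linear forms have rank 12. An identity between points can therefore be checked on
  rhombus numbers, where the table above applies.\<close>

lemma rhombus_numbers_inj: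
  assumes "\<forall>i\<in>{1..18}. rhombus_number i v = rhombus_number i w"
  shows "v = w"
proof -
  have "v$1 = w$1 \<and> v$2 = w$2 \<and> v$3 = w$3 \<and> v$4 = w$4 \<and> v$5 = w$5 \<and>
      v$6 = w$6 \<and> v$7 = w$7 \<and> v$8 = w$8 \<and> v$9 = w$9 \<and> v$10 = w$10 \<and>
      v$11 = w$11 \<and> v$12 = w$12"
    using assms unfolding ball_1_18 rhombus_number_simps by argo
  then show ?thesis
    unfolding vec_eq_iff forall_12 by simp
qed

lemma web_coord_simps:
  fixes v :: "real^12"
  defines "b \<equiv> (\<lambda>i. rhombus_number i v)"
  defines "p \<equiv> b 2 - b 3" and "q \<equiv> b 11 - b 12" and "c \<equiv> b 4 - b 13" and "d \<equiv> b 7 - b 16"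
  shows
    "web_coord v 1 = b 1"
    "web_coord v 2 = min (b 2) (b 3)"
    "web_coord v 3 = min (b 4) (b 13)"
    "web_coord v 4 = min (min (b 5) (b 6)) (min (b 14) (b 15))"
    "web_coord v 5 = min (b 7) (b 16)"
    "web_coord v 6 = min (min (b 8) (b 9)) (min (b 17) (b 18))"
    "web_coord v 7 = b 10"
    "web_coord v 8 = min (b 11) (b 12)"
    "web_coord v 9 = max 0 (min (-p) (-c))"
    "web_coord v 10 = max 0 (min (-p - q + c) (min (-p) (-p + c)))"
    "web_coord v 11 = max 0 (min p (min (p + d) (p + q + d)))"
    "web_coord v 12 = max 0 (min (-d) p)"
    "web_coord v 13 = max 0 (min (-p - q - d) (min (-q - d) (-q)))"
    "web_coord v 14 = max 0 (min (q - c) (min q (p + q - c)))"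
    "web_coord v 15 = max 0 (min c q)"
    "web_coord v 16 = max 0 (min (-q) d)"
    "web_coord v 17 = max 0 (min (-p) (min (-p + c) (min (q - c) q)))"
    "web_coord v 18 = max 0 (min (-q - d) (min (-q) (min p (p + d))))"
    "web_coord v 19 = max 0 (min (-p - d) (-d))"
    "web_coord v 20 = max 0 (min (-q + c) c)"
    "web_coord v 21 = max 0 (min d (q + d))"
    "web_coord v 22 = max 0 (min (-c) (p - c))"
  unfolding b_def p_def q_def c_def d_def by (simp_all add: web_coord_def Let_def del: minus_diff_eq uminus_add_conv_diff)

section \<open>The piecewise linear coordinates invert admissible combinations\<close>

text \<open>This rule and the next help to turn an equation with maxima and minima into a Boolean
  combination of linear inequalities, which \<open>argo\<close> decides.\<close>

lemma max_0_eq_iff: "max 0 x = a \<longleftrightarrow> 0 \<le> a \<and> x \<le> a \<and> (a = 0 \<or> a \<le> x)" for a x :: real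
  by linarith

lemma min_eq_iff_conj: "min x y = a \<longleftrightarrow> min x y \<le> a \<and> a \<le> x \<and> a \<le> y" for a x y :: real
  by linarith

text \<open>Uniqueness of the coefficients. For instance \<open>p\<close> becomes
  \<open>(a 11 + a 12 + a 18) - (a 9 + a 10 + a 17)\<close>. Every index of the first group crosses
  every index of the second, so one of the two sums vanishes and the other is the absolute value of
  \<open>p\<close>. The same happens for \<open>q\<close>, \<open>c\<close> and \<open>d\<close>,
  and the minima then isolate the single summands.\<close>

lemma web_coord_web_comb:
  assumes "admissible a"
  shows "\<forall>j\<in>{1..22}. web_coord (web_comb a) j = a j"
proof -
  have "\<forall>j\<in>{1..22}. 0 \<le> a j" and "\<forall>(j, k)\<in>set crossing_pairs. a j = 0 \<or> a k = 0"
    using assms by (auto simp: admissible_def)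
  note * = this(1)[unfolded ball_1_22] this(2)[unfolded crossing_pairs_def, simplified]
  show ?thesis
    unfolding ball_1_22 web_coord_simps rhombus_number_web_comb max_0_eq_iff min_eq_iff_conj
      min_le_iff_disj min.bounded_iff
    by (intro conjI; use * in argo)
qed

text \<open>Existence of the expansion, checked on rhombus numbers: the coordinates with index at
  least 9 account for the positive and negative parts of \<open>p\<close>, \<open>q\<close>,
  \<open>c\<close>, \<open>d\<close>, and the first eight take up the rest.\<close>

lemma web_comb_web_coord:
  assumes "\<forall>i\<in>{1..18}. 0 \<le> rhombus_number i v"
  shows "web_comb (web_coord v) = v"
proof (rule rhombus_numbers_inj)
  define b where "b i = rhombus_number i v" for i
  define w where "w j = web_coord v j" for j
  define p q c d where "p = b 2 - b 3" and "q = b 11 - b 12" and "c = b 4 - b 13" and "d = b 7 - b 16"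
  \<comment> \<open>The rhombus numbers 1, 2, 4, 5, 7, 8, 10, 11 together with \<open>p\<close>,
    \<open>q\<close>, \<open>c\<close>, \<open>d\<close> form a linear coordinate system; the other
    ten rhombus numbers are expressed in it.\<close>
  have rel: "b 3 = b 2 - p" "b 6 = b 5 - p" "b 9 = b 8 - p" "b 12 = b 11 - q" "b 14 = b 5 + q + d"
    "b 15 = b 5 + d" "b 17 = b 8 - p + c" "b 18 = b 8 - p + c - q" "b 13 = b 4 - c" "b 16 = b 7 - d"
    unfolding p_def q_def c_def d_def b_def rhombus_number_simps by argo+
  note coord = web_coord_simps[of v, folded b_def w_def, folded p_def q_def c_def d_def]
  \<comment> \<open>The last two equations serve \<open>w 4\<close> and \<open>w 6\<close>: the
    minimum of \<open>b 5\<close>, \<open>b 6\<close>, \<open>b 14\<close>, \<open>b 15\<close>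
    equals \<open>b 5 - max 0 p - max 0 (max (-q - d) (-d) - max 0 p)\<close>, and similarly for
    \<open>b 8\<close>, \<open>b 9\<close>, \<open>b 17\<close>, \<open>b 18\<close>.\<close>
  have pl: "max 0 p = w 11 + w 12 + w 18"
    "max 0 (-p) = w 9 + w 10 + w 17"
    "max 0 c = w 15 + w 20"
    "max 0 (-c) = w 9 + w 22"
    "max 0 d = w 16 + w 21"
    "max 0 (-d) = w 12 + w 19"
    "max 0 q = w 14 + w 15 + w 17"
    "max 0 (-q) = w 13 + w 16 + w 18"
    "max 0 (max (-q - d) (-d) - max 0 p) = w 13 + w 19"
    "max 0 (max (p - c) (p - c + q) - max 0 p) = w 14 + w 22"
    using [[smt_timeout = 120]] unfolding coord by (smt (verit))+
  have parts: "x = max 0 x - max 0 (-x)" for x :: real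
    by simp
  have diff: "p = (w 11 + w 12 + w 18) - (w 9 + w 10 + w 17)" "q = (w 14 + w 15 + w 17) - (w 13 + w 16 + w 18)"
    "c = (w 15 + w 20) - (w 9 + w 22)" "d = (w 16 + w 21) - (w 12 + w 19)"
    by (fact parts[of p, unfolded pl] parts[of q, unfolded pl] parts[of c, unfolded pl] parts[of d, unfolded pl])+
  have corner: "w 1 = b 1" "w 2 = b 2 - (w 11 + w 12 + w 18)" "w 3 = b 4 - (w 15 + w 20)"
    "w 4 = b 5 - (w 11 + w 12 + w 18) - (w 13 + w 19)" "w 5 = b 7 - (w 16 + w 21)"
    "w 6 = b 8 - (w 11 + w 12 + w 18) - (w 14 + w 22)" "w 7 = b 10" "w 8 = b 11 - (w 14 + w 15 + w 17)"
    unfolding coord(1-8) pl[symmetric] rel by (smt (verit))+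
  show "\<forall>i\<in>{1..18}. rhombus_number i (web_comb (web_coord v)) = rhombus_number i v"
    unfolding ball_1_18 rhombus_number_web_comb w_def[symmetric] b_def[symmetric] rel
    using corner diff by (intro conjI; linarith)
qed

text \<open>For each crossing pair the two minima contain a linear form and its negative, so the two
  coordinates are never both positive. For example, \<open>(10, 14)\<close> is settled by
  \<open>-p - q + c\<close> and \<open>p + q - c\<close>.\<close>

lemma admissible_web_coord:
  assumes "\<forall>i\<in>{1..18}. 0 \<le> rhombus_number i v"
  shows "admissible (web_coord v)"
proof -
  have "\<forall>j\<in>{1..22}. 0 \<le> web_coord v j"
    using assms unfolding ball_1_22 ball_1_18 web_coord_simps by simp
  moreover have "max 0 x = 0 \<longleftrightarrow> x \<le> 0" for x :: real
    by linarith
  then have "\<forall>(j, k)\<in>set crossing_pairs. web_coord v j = 0 \<or> web_coord v k = 0"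
    unfolding crossing_pairs_def list.set ball_simps prod.case web_coord_simps
    by (simp only: min_le_iff_disj) (intro conjI TrueI; argo)
  ultimately show ?thesis by (simp add: admissible_def)
qed

section \<open>Combinatorics of the index sets\<close>

lemma web_index_lists_props:
  "\<forall>xs\<in>set web_index_lists. distinct xs \<and> length xs = 4 \<and> set xs \<subseteq> {9..22} \<and>
     (\<forall>(j, k)\<in>set crossing_pairs. j \<notin> set xs \<or> k \<notin> set xs)"
  by code_simp

text \<open>The length counts positions in \<open>web_index_lists\<close>, so the value 1 gives
  uniqueness of the index and not only of the set.\<close>

lemma web_index_lists_unique_neighbour:
  "\<forall>xs\<in>set web_index_lists. \<forall>j\<in>set xs.
     length (filter (\<lambda>ys. j \<notin> set ys \<and> (\<forall>k\<in>set xs. k = j \<or> k \<in> set ys)) web_index_lists) = 1"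
  by code_simp

lemma length_web_index_lists: "length web_index_lists = 42"
  by (simp add: web_index_lists_def)

lemma web_index_eq: "web_index i = set (web_index_lists ! (i - 1))" if "i \<in> {1..42}"
proof -
  have "web_index i = map set web_index_lists ! (i - 1)"
    by (simp add: web_index_def web_index_lists_def)
  moreover have "i - 1 < length web_index_lists"
    using that by (auto simp: length_web_index_lists)
  ultimately show ?thesis
    by simp
qed

text \<open>Only the truth values of \<open>a j = 0\<close> for \<open>j\<close> from 9 to 22
  matter, so the claim is propositional: every subset of these indices without a crossing pair lies
  in one of the 42 sets.\<close>

lemma noncrossing_support:
  assumes "\<forall>(j, k)\<in>set crossing_pairs. a j = 0 \<or> a k = (0::real)"
  shows "\<exists>i\<in>{1..42}. \<forall>j\<in>{9..22}. j \<notin> web_index i \<longrightarrow> a j = 0"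
proof -
  have interval: "{9..22::nat} = set [9..<23]"
    unfolding set_upt by auto
  have "\<exists>xs\<in>set web_index_lists. \<forall>j\<in>{9..22}. j \<notin> set xs \<longrightarrow> a j = 0"
    using assms unfolding interval crossing_pairs_def web_index_lists_def
    by (simp only: upt_rec_numeral list.set bex_simps ball_simps prod.case) (simp, argo)
  then obtain xs where xs: "xs \<in> set web_index_lists" "\<forall>j\<in>{9..22}. j \<notin> set xs \<longrightarrow> a j = 0"
    by blast
  then obtain n where n: "n < 42" "web_index_lists ! n = xs"
    using in_set_conv_nth[of xs web_index_lists] unfolding length_web_index_lists by blast
  then have "web_index (Suc n) = set xs" "Suc n \<in> {1..42}"
    using web_index_eq[of "Suc n"] by simp_all
  then show ?thesis
    using xs(2) by blast
qed

lemma web_index_props: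
  assumes "i \<in> {1..42}"
  shows "web_index i \<subseteq> {9..22}" "card (web_index i) = 4"
    "\<forall>(j, k)\<in>set crossing_pairs. j \<notin> web_index i \<or> k \<notin> web_index i"
proof -
  have "web_index_lists ! (i - 1) \<in> set web_index_lists"
    using assms by (intro nth_mem) (auto simp: length_web_index_lists)
  note * = bspec[OF web_index_lists_props this]
  show "web_index i \<subseteq> {9..22}" "card (web_index i) = 4"
    "\<forall>(j, k)\<in>set crossing_pairs. j \<notin> web_index i \<or> k \<notin> web_index i"
    using * by (simp_all add: web_index_eq[OF assms] distinct_card)
qed

lemma web_index_finite: "finite (web_index i)" if "i \<in> {1..42}"
  using web_index_props(1)[OF that] finite_subset by blast

lemma ex1_web_index_neighbour:
  assumes i: "i \<in> {1..42}" and j: "j \<in> web_index i"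
  shows "\<exists>!k. k \<in> {1..42} \<and> web_index i \<inter> web_index k = web_index i - {j}"
proof -
  let ?xs = "web_index_lists ! (i - 1)"
  let ?P = "\<lambda>ys. j \<notin> set ys \<and> (\<forall>k\<in>set ?xs. k = j \<or> k \<in> set ys)"
  have "?xs \<in> set web_index_lists"
    using i by (intro nth_mem) (auto simp: length_web_index_lists)
  moreover have "j \<in> set ?xs"
    using j web_index_eq[OF i] by simp
  ultimately have "length (filter ?P web_index_lists) = 1"
    using web_index_lists_unique_neighbour by blast
  then have "card {n. n < 42 \<and> ?P (web_index_lists ! n)} = 1"
    unfolding length_filter_conv_card length_web_index_lists .
  then obtain n where n: "{n. n < 42 \<and> ?P (web_index_lists ! n)} = {n}"
    by (auto simp: card_1_singleton_iff)
  \<comment> \<open>Positions in the list count from 0 and sectors from 1, hence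
    \<open>k - 1\<close> here and \<open>Suc n\<close> below.\<close>
  have P: "web_index i \<inter> web_index k = web_index i - {j} \<longleftrightarrow> ?P (web_index_lists ! (k - 1))"
    if "k \<in> {1..42}" for k
    using j unfolding web_index_eq[OF i] web_index_eq[OF that] by blast
  show ?thesis
  proof (rule ex1I)
    have "n < 42" and "?P (web_index_lists ! n)"
      using n by auto
    then show "Suc n \<in> {1..42} \<and> web_index i \<inter> web_index (Suc n) = web_index i - {j}"
      using P[of "Suc n"] by simp
  next
    fix k assume k: "k \<in> {1..42} \<and> web_index i \<inter> web_index k = web_index i - {j}"
    then have "?P (web_index_lists ! (k - 1))" and "0 < k" "k \<le> 42"
      using P[of k] by simp_all
    then have "k - 1 \<in> {n}"
      unfolding n[symmetric] by simp
    with \<open>0 < k\<close> show "k = Suc n"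
      by simp
  qed
qed

text \<open>Both sets have four elements and share three, so each has exactly one element outside
  the other.\<close>

lemma web_index_exchange:
  assumes "i \<in> {1..42}" "k \<in> {1..42}" "j \<in> web_index i"
    and eq: "web_index i \<inter> web_index k = web_index i - {j}"
  shows "\<exists>j'. j' \<noteq> j \<and> j' \<notin> web_index i \<and> web_index k = insert j' (web_index i - {j})"
proof -
  have "card (web_index k - web_index i) = card (web_index k) - card (web_index k \<inter> web_index i)"
    using web_index_finite[OF assms(2)] by (intro card_Diff_subset_Int) auto
  also have "web_index k \<inter> web_index i = web_index i - {j}"
    using eq by blast
  also have "card (web_index k) - card (web_index i - {j}) = 1"
    using assms(3) web_index_props(2)[OF assms(1)] web_index_props(2)[OF assms(2)] by simp
  finally obtain j' where "web_index k - web_index i = {j'}"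
    by (auto simp: card_1_singleton_iff)
  then show ?thesis
    using eq assms(3) by (intro exI[of _ j']) blast
qed

text \<open>Distinctness of the 42 sets follows from uniqueness of neighbours. If
  \<open>web_index i = web_index l\<close>, exchanging some \<open>j\<close> for \<open>j'\<close>
  leads to a neighbour \<open>web_index k\<close>; then \<open>i\<close> and \<open>l\<close> are
  both the neighbour of \<open>k\<close> that omits \<open>j'\<close>.\<close>

lemma web_index_inter_card_less:
  assumes "i \<in> {1..42}" "l \<in> {1..42}" "i \<noteq> l"
  shows "card (web_index i \<inter> web_index l) < 4"
proof (rule ccontr)
  assume "\<not> ?thesis"
  then have "card (web_index i) \<le> card (web_index i \<inter> web_index l)"
      "card (web_index l) \<le> card (web_index i \<inter> web_index l)"
    by (simp_all add: web_index_props(2)[OF assms(1)] web_index_props(2)[OF assms(2)])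
  then have "web_index i \<inter> web_index l = web_index i" "web_index i \<inter> web_index l = web_index l"
    using card_seteq[OF web_index_finite[OF assms(1)] inf_le1] card_seteq[OF web_index_finite[OF assms(2)] inf_le2]
    by simp_all
  then have eq: "web_index i = web_index l"
    by simp
  obtain j where j: "j \<in> web_index i"
    using web_index_props(2)[OF assms(1)] by fastforce
  then obtain k where k: "k \<in> {1..42}" "web_index i \<inter> web_index k = web_index i - {j}"
    using ex1_web_index_neighbour[OF assms(1) j] by (elim ex1E conjE)
  obtain j' where j': "j' \<notin> web_index i" "web_index k = insert j' (web_index i - {j})"
    using web_index_exchange[OF assms(1) k(1) j k(2)] by blast
  have j'k: "j' \<in> web_index k" and "web_index k \<inter> web_index i = web_index k - {j'}"
    unfolding j'(2) using j'(1) by blast+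
  then have "i \<in> {1..42} \<and> web_index k \<inter> web_index i = web_index k - {j'}"
    "l \<in> {1..42} \<and> web_index k \<inter> web_index l = web_index k - {j'}"
    using assms eq by simp_all
  then have "i = l"
    using ex1_web_index_neighbour[OF k(1) j'k] by (elim ex1E) metis
  with \<open>i \<noteq> l\<close> show False ..
qed

section \<open>Nonnegative spans, rank and dimension\<close>

text \<open>Attaching the coefficients to indices rather than to vectors matches
  \<open>web_comb\<close>, whose sum runs over indices.\<close>

lemma nonneg_span_image:
  assumes "finite K"
  shows "nonneg_span (f ` K) = {\<Sum>j\<in>K. a j *\<^sub>R f j | a. \<forall>j\<in>K. 0 \<le> a j}" (is "_ = ?R")
proof
  show "nonneg_span (f ` K) \<subseteq> ?R"
    unfolding nonneg_span_eq_convex_cone_hull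
  proof (rule hull_minimal)
    show "f ` K \<subseteq> ?R"
    proof clarify
      fix k assume "k \<in> K"
      then have "f k = (\<Sum>j\<in>K. (if j = k then 1 else 0) *\<^sub>R f j)"
        using assms by (simp add: if_distrib[where f = "\<lambda>c. c *\<^sub>R _"] cong: if_cong)
      then show "\<exists>a. f k = (\<Sum>j\<in>K. a j *\<^sub>R f j) \<and> (\<forall>j\<in>K. 0 \<le> a j)"
        by (intro exI[of _ "\<lambda>j. if j = k then 1 else 0"]) simp
    qed
    show "convex_cone ?R"
      unfolding convex_cone_iff
    proof (intro conjI ballI allI impI)
      show "0 \<in> ?R"
        by (intro CollectI exI[of _ "\<lambda>_. 0"]) simp
    next
      fix x y assume "x \<in> ?R" "y \<in> ?R"
      then obtain a b where "x = (\<Sum>j\<in>K. a j *\<^sub>R f j)" "\<forall>j\<in>K. 0 \<le> a j"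
        "y = (\<Sum>j\<in>K. b j *\<^sub>R f j)" "\<forall>j\<in>K. 0 \<le> b j" by blast
      then show "x + y \<in> ?R"
        by (intro CollectI exI[of _ "\<lambda>j. a j + b j"]) (simp add: scaleR_add_left sum.distrib)
    next
      fix x and t :: real assume "x \<in> ?R" "0 \<le> t"
      then obtain a where "x = (\<Sum>j\<in>K. a j *\<^sub>R f j)" "\<forall>j\<in>K. 0 \<le> a j" by blast
      with \<open>0 \<le> t\<close> show "t *\<^sub>R x \<in> ?R"
        by (intro CollectI exI[of _ "\<lambda>j. t * a j"]) (simp add: scaleR_sum_right)
    qed
  qed
next
  have "(\<Sum>j\<in>L. a j *\<^sub>R f j) \<in> nonneg_span (f ` K)" if "finite L" "L \<subseteq> K" "\<forall>j\<in>K. 0 \<le> a j" for L a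
    using that(1,2)
  proof (induction L)
    case empty
    then show ?case
      unfolding nonneg_span_eq_convex_cone_hull by (simp add: convex_cone_hull_contains_0)
  next
    case (insert k L)
    then show ?case
      using that(3) unfolding nonneg_span_eq_convex_cone_hull
      by (simp add: convex_cone_hull_add convex_cone_hull_mul hull_inc)
  qed
  then show "?R \<subseteq> nonneg_span (f ` K)"
    using assms by blast
qed

lemma cone_rank_le: "cone_rank (nonneg_span S) \<le> card S" if "finite S"
  unfolding cone_rank_def using that by (intro Least_le) blast

lemma dim_nonneg_span: "dim (nonneg_span S) = dim S"
  for S :: "'a::euclidean_space set"
proof (rule antisym)
  have "nonneg_span S \<subseteq> span S"
    unfolding nonneg_span_def by (fastforce intro: span_sum span_scale span_base)
  then show "dim (nonneg_span S) \<le> dim S"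
    using dim_subset dim_span by metis
  show "dim S \<le> dim (nonneg_span S)"
    unfolding nonneg_span_eq_convex_cone_hull by (intro dim_subset hull_subset)
qed

text \<open>A generating set of least size also spans linearly, so it has at least
  \<open>dim C\<close> elements.\<close>

lemma dim_le_cone_rank: "dim C \<le> cone_rank C" if "real_cone C"
proof -
  have "\<exists>k S. finite S \<and> card S = k \<and> C = nonneg_span S"
    using that unfolding real_cone_def by blast
  from LeastI_ex[OF this] obtain S where S: "finite S" "card S = cone_rank C" "C = nonneg_span S"
    unfolding cone_rank_def by blast
  then show ?thesis
    using dim_le_card'[of S] by (simp add: dim_nonneg_span)
qed

section \<open>Faces of sectors\<close>

definition web_indices :: "nat \<Rightarrow> nat set" where
  "web_indices i = {1..8} \<union> web_index i"

lemma web_indices_subset: "web_indices i \<subseteq> {1..22}" if "i \<in> {1..42}"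
  using web_index_props(1)[OF that] by (auto simp: web_indices_def)

lemma crossing_pairs_ge_9: "\<forall>(j, k)\<in>set crossing_pairs. 9 \<le> j \<and> 9 \<le> k"
  by (simp add: crossing_pairs_def)

lemma admissible_supported:
  assumes "i \<in> {1..42}" "\<forall>j\<in>{1..22}. 0 \<le> a j" "\<forall>j. j \<notin> web_indices i \<longrightarrow> a j = 0"
  shows "admissible a"
  using assms web_index_props(3)[OF assms(1)] crossing_pairs_ge_9
  unfolding admissible_def web_indices_def by fastforce

lemma web_coord_web_comb_supported:
  assumes "i \<in> {1..42}" "\<forall>j\<in>{1..22}. 0 \<le> a j" "\<forall>j. j \<notin> web_indices i \<longrightarrow> a j = 0" "j \<in> {1..22}"
  shows "web_coord (web_comb a) j = a j"
  using web_coord_web_comb[OF admissible_supported[OF assms(1-3)]] assms(4) by blast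

lemma web_comb_eq_sum: "web_comb a = (\<Sum>j\<in>K. a j *\<^sub>R web_vec j)"
  if "K \<subseteq> {1..22}" "\<forall>j\<in>{1..22} - K. a j = 0"
  unfolding web_comb_def using that by (intro sum.mono_neutral_right) auto

lemma web_comb_cong: "web_comb a = web_comb b" if "\<forall>j\<in>{1..22}. a j = b j"
  unfolding web_comb_def using that by (intro sum.cong) auto

text \<open>The right-hand side does not mention \<open>i\<close>: membership in a face of any
  sector is a support condition on the same coordinates of \<open>v\<close>. This makes faces of
  different sectors comparable.\<close>

lemma mem_nonneg_span_web_vec:
  assumes i: "i \<in> {1..42}" and K: "K \<subseteq> web_indices i"
  shows "v \<in> nonneg_span (web_vec ` K) \<longleftrightarrow>
    v = web_comb (web_coord v) \<and> (\<forall>j\<in>{1..22}. 0 \<le> web_coord v j) \<and> (\<forall>j\<in>{1..22} - K. web_coord v j = 0)"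
    (is "_ \<longleftrightarrow> ?R")
proof -
  have sub: "K \<subseteq> {1..22}"
    using K web_indices_subset[OF i] by blast
  then have span: "nonneg_span (web_vec ` K) = {\<Sum>j\<in>K. a j *\<^sub>R web_vec j | a. \<forall>j\<in>K. 0 \<le> a j}"
    by (intro nonneg_span_image) (rule finite_subset, auto)
  show ?thesis
  proof
    assume "v \<in> nonneg_span (web_vec ` K)"
    then obtain a where a: "v = (\<Sum>j\<in>K. a j *\<^sub>R web_vec j)" "\<forall>j\<in>K. 0 \<le> a j"
      unfolding span by blast
    \<comment> \<open>Extended by zero, the coefficients are supported in a single sector, so
      \<open>web_coord\<close> recovers them.\<close>
    define b where "b j = (if j \<in> K then a j else 0)" for j
    have v: "v = web_comb b"
      using web_comb_eq_sum[OF sub, of b] by (simp add: b_def a(1))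
    have coord: "web_coord v j = b j" if "j \<in> {1..22}" for j
      unfolding v using i that a(2) K
      by (intro web_coord_web_comb_supported[OF i]) (auto simp: b_def)
    moreover have "web_comb (web_coord v) = web_comb b"
      using coord by (intro web_comb_cong) blast
    ultimately show ?R
      using v a(2) by (auto simp: b_def)
  next
    assume ?R
    then show "v \<in> nonneg_span (web_vec ` K)"
      unfolding span using web_comb_eq_sum[OF sub, of "web_coord v"] sub
      by (intro CollectI exI[of _ "web_coord v"]) (metis subsetD)
  qed
qed

text \<open>Vanishing outside \<open>K\<close> and outside \<open>L\<close> together amount to
  vanishing outside their intersection.\<close>

lemma nonneg_span_web_vec_Int:
  assumes "i \<in> {1..42}" "K \<subseteq> web_indices i" "l \<in> {1..42}" "L \<subseteq> web_indices l"
  shows "nonneg_span (web_vec ` K) \<inter> nonneg_span (web_vec ` L) = nonneg_span (web_vec ` (K \<inter> L))"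
proof -
  have "K \<inter> L \<subseteq> web_indices i"
    using assms(2) by blast
  then show ?thesis
    unfolding set_eq_iff Int_iff mem_nonneg_span_web_vec[OF assms(1,2)]
      mem_nonneg_span_web_vec[OF assms(3,4)] mem_nonneg_span_web_vec[OF assms(1) \<open>K \<inter> L \<subseteq> _\<close>]
    by blast
qed

text \<open>Split by sign, the relation equates two nonnegative combinations in one sector. By
  uniqueness their coefficients agree, so the positive and the negative part of \<open>c j\<close>
  coincide and are both 0.\<close>

lemma web_vec_sum_eq_0:
  assumes i: "i \<in> {1..42}" and "(\<Sum>j\<in>web_indices i. c j *\<^sub>R web_vec j) = 0" and "j \<in> web_indices i"
  shows "c j = 0"
proof -
  define a where "a j = (if j \<in> web_indices i then max 0 (c j) else 0)" for j
  define b where "b j = (if j \<in> web_indices i then max 0 (- c j) else 0)" for j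
  have c: "c j = a j - b j" if "j \<in> web_indices i" for j
    using that by (auto simp: a_def b_def)
  have "web_comb a = (\<Sum>j\<in>web_indices i. a j *\<^sub>R web_vec j)"
    "web_comb b = (\<Sum>j\<in>web_indices i. b j *\<^sub>R web_vec j)"
    by (intro web_comb_eq_sum web_indices_subset[OF i]; simp add: a_def b_def)+
  moreover have "(\<Sum>j\<in>web_indices i. c j *\<^sub>R web_vec j) =
      (\<Sum>j\<in>web_indices i. a j *\<^sub>R web_vec j) - (\<Sum>j\<in>web_indices i. b j *\<^sub>R web_vec j)"
    unfolding sum_subtractf[symmetric] scaleR_diff_left[symmetric] by (intro sum.cong) (auto simp: c)
  ultimately have "web_comb a = web_comb b"
    using assms(2) by simp
  moreover have "web_coord (web_comb a) j = a j" "web_coord (web_comb b) j = b j"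
    using assms(3) web_indices_subset[OF i]
    by (intro web_coord_web_comb_supported[OF i]; auto simp: a_def b_def)+
  ultimately show ?thesis
    using assms(3) by (auto simp: a_def b_def)
qed

text \<open>Independence concerns the set of vectors, so coincidences between generators have to be
  excluded; one would be a relation with coefficients 1 and -1.\<close>

lemma inj_on_web_vec: "inj_on web_vec (web_indices i)" if i: "i \<in> {1..42}"
proof (rule inj_onI, rule ccontr)
  fix j k assume jk: "j \<in> web_indices i" "k \<in> web_indices i" "web_vec j = web_vec k" "j \<noteq> k"
  have fin: "finite (web_indices i)"
    using web_indices_subset[OF i] finite_subset by blast
  have "(\<Sum>m\<in>web_indices i. (if m = j then 1 else 0) *\<^sub>R web_vec m) = web_vec j"
    "(\<Sum>m\<in>web_indices i. (if m = k then 1 else 0) *\<^sub>R web_vec m) = web_vec k"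
    using fin jk by (simp_all add: if_distrib[where f = "\<lambda>c. c *\<^sub>R _"] cong: if_cong)
  then have "(\<Sum>m\<in>web_indices i. ((if m = j then 1 else 0) - (if m = k then 1 else 0)) *\<^sub>R web_vec m) = 0"
    by (simp add: scaleR_diff_left sum_subtractf jk(3))
  from web_vec_sum_eq_0[OF i this jk(1)] show False
    using jk(4) by simp
qed

lemma independent_web_vec: "independent (web_vec ` web_indices i)" if i: "i \<in> {1..42}"
proof (rule independent_if_scalars_zero)
  show "finite (web_vec ` web_indices i)"
    using web_indices_subset[OF i] finite_subset by blast
next
  fix f x assume "(\<Sum>x\<in>web_vec ` web_indices i. f x *\<^sub>R x) = 0" "x \<in> web_vec ` web_indices i"
  then obtain j where "j \<in> web_indices i" "x = web_vec j"
    "(\<Sum>j\<in>web_indices i. f (web_vec j) *\<^sub>R web_vec j) = 0"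
    by (auto simp: sum.reindex[OF inj_on_web_vec[OF i]])
  then show "f x = 0"
    using web_vec_sum_eq_0[OF i, of "\<lambda>j. f (web_vec j)"] by simp
qed

lemma dim_nonneg_span_web_vec:
  assumes i: "i \<in> {1..42}" and "K \<subseteq> web_indices i"
  shows "dim (nonneg_span (web_vec ` K)) = card K"
proof -
  have "independent (web_vec ` K)"
    using independent_mono[OF independent_web_vec[OF i] image_mono[OF assms(2)]] .
  moreover have "inj_on web_vec K"
    using inj_on_web_vec[OF i] assms(2) by (rule inj_on_subset)
  ultimately show ?thesis
    by (simp add: dim_nonneg_span dim_eq_card_independent card_image)
qed

lemma card_web_indices_Int:
  assumes "i \<in> {1..42}" "K \<subseteq> web_index i"
  shows "card ({1..8} \<union> K) = 8 + card K"
proof -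
  have "K \<subseteq> {9..22}"
    using web_index_props(1)[OF assms(1)] assms(2) by blast
  then have "finite K" "{1..8} \<inter> K = {}"
    by (auto intro: finite_subset)
  then show ?thesis
    by (simp add: card_Un_disjoint)
qed

section \<open>The completion as the union of the sectors\<close>

lemma web_vec_eq_web_comb: "web_vec j = web_comb (\<lambda>k. if k = j then 1 else 0)" if "j \<in> {1..22}"
  using web_comb_eq_sum[of "{j}" "\<lambda>k. if k = j then 1 else 0"] that by simp

lemma web_vec_in_KTGS_cone: "web_vec j \<in> KTGS_cone" if j: "j \<in> {1..22}"
proof -
  have "\<forall>j\<in>{1..22}. \<forall>k. web_vec j $ k \<in> \<int>"
    unfolding ball_1_22 forall_12 web_vec_simps vector_12 by simp
  moreover have "\<forall>i\<in>{1..18}. rhombus_number i (web_comb a) \<in> \<nat>" if "\<And>j. a j \<in> \<nat>" for a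
    unfolding ball_1_18 rhombus_number_web_comb using that by (intro conjI Nats_add)
  \<comment> \<open>Unit coefficients are natural numbers, and the table only adds them.\<close>
  from this[of "\<lambda>k. if k = j then 1 else 0"] have "\<forall>i\<in>{1..18}. rhombus_number i (web_vec j) \<in> \<nat>"
    unfolding web_vec_eq_web_comb[OF j] by simp
  ultimately show ?thesis
    using j by (simp add: KTGS_cone_def)
qed

text \<open>An upper bound for the completion that is given by real inequalities alone; by
  \<open>rhombus_cone_subset\<close> and \<open>UN_KTGS_sector\<close> the two coincide.\<close>

definition rhombus_cone :: "(real^12) set" where
  "rhombus_cone = {v. \<forall>i\<in>{1..18}. 0 \<le> rhombus_number i v}"

lemma convex_cone_rhombus_cone: "convex_cone rhombus_cone"
  unfolding convex_cone_iff
proof (intro conjI ballI allI impI)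
  show "0 \<in> rhombus_cone"
    unfolding rhombus_cone_def mem_Collect_eq ball_1_18 rhombus_number_simps by simp
next
  fix v w assume "v \<in> rhombus_cone" "w \<in> rhombus_cone"
  moreover have "\<forall>i\<in>{1..18}. rhombus_number i (v + w) = rhombus_number i v + rhombus_number i w"
    unfolding ball_1_18 rhombus_number_simps vector_add_component by argo
  ultimately show "v + w \<in> rhombus_cone"
    unfolding rhombus_cone_def by simp
next
  fix v and t :: real assume "v \<in> rhombus_cone" "0 \<le> t"
  moreover have "\<forall>i\<in>{1..18}. rhombus_number i (t *\<^sub>R v) = t * rhombus_number i v"
    unfolding ball_1_18 rhombus_number_simps vector_scaleR_component by (simp add: algebra_simps add_divide_distrib diff_divide_distrib)
  ultimately show "t *\<^sub>R v \<in> rhombus_cone"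
    unfolding rhombus_cone_def by simp
qed

lemma KTGS_completion_subset_rhombus_cone: "KTGS_completion \<subseteq> rhombus_cone"
  unfolding KTGS_completion_def nonneg_span_eq_convex_cone_hull
proof (rule hull_minimal)
  have "0 \<le> x" if "x \<in> \<nat>" for x :: real
    using that by (auto elim: Nats_cases)
  then show "KTGS_cone \<subseteq> rhombus_cone"
    unfolding KTGS_cone_def rhombus_cone_def by blast
qed (rule convex_cone_rhombus_cone)

lemma KTGS_sector_eq: "KTGS_sector i = nonneg_span (web_vec ` web_indices i)"
  by (simp add: KTGS_sector_def web_indices_def)

lemma rhombus_cone_subset: "rhombus_cone \<subseteq> (\<Union>i\<in>{1..42}. KTGS_sector i)"
proof
  fix v assume "v \<in> rhombus_cone"
  then have nn: "\<forall>i\<in>{1..18}. 0 \<le> rhombus_number i v"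
    by (simp add: rhombus_cone_def)
  note adm = admissible_web_coord[OF nn, unfolded admissible_def]
  obtain i where i: "i \<in> {1..42}" "\<forall>j\<in>{9..22}. j \<notin> web_index i \<longrightarrow> web_coord v j = 0"
    using noncrossing_support[OF conjunct2[OF adm]] by blast
  \<comment> \<open>The corner indices 1 to 8 lie in every sector, so only the support from 9 on has
    to fit.\<close>
  have "web_coord v j = 0" if "j \<in> {1..22} - web_indices i" for j
    using i(2) that by (auto simp: web_indices_def not_le)
  then have "v \<in> KTGS_sector i"
    unfolding KTGS_sector_eq mem_nonneg_span_web_vec[OF i(1) order_refl]
    using adm web_comb_web_coord[OF nn] by auto
  then show "v \<in> (\<Union>i\<in>{1..42}. KTGS_sector i)"
    using i(1) by blast
qed

lemma nonneg_span_mono: "nonneg_span S \<subseteq> nonneg_span T" if "S \<subseteq> T"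
  using that unfolding nonneg_span_eq_convex_cone_hull by (rule hull_mono)

lemma KTGS_sector_subset: "KTGS_sector i \<subseteq> KTGS_completion" if "i \<in> {1..42}"
  unfolding KTGS_sector_eq KTGS_completion_def
  using web_vec_in_KTGS_cone web_indices_subset[OF that] by (intro nonneg_span_mono) blast

text \<open>The inclusions close up: the completion lies in \<open>rhombus_cone\<close>, this lies
  in the union, and the union lies in the completion.\<close>

lemma UN_KTGS_sector: "(\<Union>i\<in>{1..42}. KTGS_sector i) = KTGS_completion"
  using KTGS_sector_subset KTGS_completion_subset_rhombus_cone rhombus_cone_subset by blast

text \<open>\<open>KTGS_cone\<close> is infinite, while \<open>real_cone\<close> asks for a finite
  generating set.\<close>

lemma KTGS_completion_eq: "KTGS_completion = nonneg_span (web_vec ` {1..22})"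
proof
  have "KTGS_sector i \<subseteq> nonneg_span (web_vec ` {1..22})" if "i \<in> {1..42}" for i
    unfolding KTGS_sector_eq using web_indices_subset[OF that] by (intro nonneg_span_mono) blast
  then show "KTGS_completion \<subseteq> nonneg_span (web_vec ` {1..22})"
    unfolding UN_KTGS_sector[symmetric] by blast
  show "nonneg_span (web_vec ` {1..22}) \<subseteq> KTGS_completion"
    unfolding KTGS_completion_def using web_vec_in_KTGS_cone by (intro nonneg_span_mono) blast
qed

section \<open>Dimensions, walls and the decomposition\<close>

lemma dim_KTGS_sector: "dim (KTGS_sector i) = 12" if "i \<in> {1..42}"
  using dim_nonneg_span_web_vec[OF that order_refl] card_web_indices_Int[OF that order_refl]
    web_index_props(2)[OF that]
  by (simp add: KTGS_sector_eq web_indices_def)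

lemma real_cone_nonneg_span_web_vec: "real_cone (nonneg_span (web_vec ` K))" if "finite K"
  unfolding real_cone_def using that by blast

lemma finite_web_indices: "finite (web_indices i)" if "i \<in> {1..42}"
  using web_indices_subset[OF that] finite_subset by blast

lemma full_KTGS_sector: "full_cone (KTGS_sector i)" if "i \<in> {1..42}"
  using dim_KTGS_sector[OF that] real_cone_nonneg_span_web_vec[OF finite_web_indices[OF that]]
  by (simp add: full_cone_def KTGS_sector_eq)

text \<open>The rank is squeezed between the dimension and the number of generators, which agree by
  independence.\<close>

lemma sector_KTGS_sector: "sector (KTGS_sector i)" if i: "i \<in> {1..42}"
proof -
  have rc: "real_cone (KTGS_sector i)"
    using full_KTGS_sector[OF i] by (simp add: full_cone_def)
  have "cone_rank (KTGS_sector i) \<le> card (web_vec ` web_indices i)"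
    unfolding KTGS_sector_eq using finite_web_indices[OF i] by (intro cone_rank_le) simp
  also have "\<dots> = dim (KTGS_sector i)"
    unfolding KTGS_sector_eq dim_nonneg_span_web_vec[OF i order_refl]
    by (rule card_image[OF inj_on_web_vec[OF i]])
  finally show ?thesis
    using rc dim_le_cone_rank[OF rc] by (simp add: sector_def)
qed

lemma dim_KTGS_completion: "dim KTGS_completion = 12"
proof (rule antisym)
  show "dim KTGS_completion \<le> 12"
    using dim_subset_UNIV[of KTGS_completion] by simp
  show "12 \<le> dim KTGS_completion"
    using dim_subset[OF KTGS_sector_subset[of 1]] dim_KTGS_sector[of 1] by simp
qed

lemma full_KTGS_completion: "full_cone KTGS_completion"
  using dim_KTGS_completion real_cone_nonneg_span_web_vec[of "{1..22}"]
  by (simp add: full_cone_def KTGS_completion_eq)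

lemma KTGS_sector_Int:
  assumes "i \<in> {1..42}" "l \<in> {1..42}"
  shows "KTGS_sector i \<inter> KTGS_sector l = nonneg_span (web_vec ` ({1..8} \<union> (web_index i \<inter> web_index l)))"
proof -
  have "web_indices i \<inter> web_indices l = {1..8} \<union> (web_index i \<inter> web_index l)"
    by (auto simp: web_indices_def)
  then show ?thesis
    unfolding KTGS_sector_eq
    using nonneg_span_web_vec_Int[OF assms(1) order_refl assms(2) order_refl] by simp
qed

lemma dim_KTGS_sector_Int:
  assumes "i \<in> {1..42}" "l \<in> {1..42}"
  shows "dim (KTGS_sector i \<inter> KTGS_sector l) = 8 + card (web_index i \<inter> web_index l)"
  unfolding KTGS_sector_Int[OF assms]
  using dim_nonneg_span_web_vec[OF assms(1), of "{1..8} \<union> (web_index i \<inter> web_index l)"]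
    card_web_indices_Int[OF assms(1), of "web_index i \<inter> web_index l"]
  by (auto simp: web_indices_def)

text \<open>The eight corner vectors are common to all sectors, so dimension 11 means three further
  common indices.\<close>

lemma intersect_in_wall_iff:
  assumes "i \<in> {1..42}" "l \<in> {1..42}"
  shows "intersect_in_wall (KTGS_sector i) (KTGS_sector l) \<longleftrightarrow> card (web_index i \<inter> web_index l) = 3"
proof -
  have "real_cone (KTGS_sector i \<inter> KTGS_sector l)"
    unfolding KTGS_sector_Int[OF assms] using web_index_finite[OF assms(1)]
    by (intro real_cone_nonneg_span_web_vec) simp
  then show ?thesis
    using full_KTGS_sector assms dim_KTGS_sector_Int[OF assms] by (auto simp: intersect_in_wall_def)
qed

lemma sector_decomposition_KTGS: "sector_decomposition {1..42} KTGS_sector KTGS_completion"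
proof -
  \<comment> \<open>At most three common indices from 9 on leave dimension at most 11.\<close>
  have "interior (KTGS_sector i \<inter> KTGS_sector l) = {}" if "i \<in> {1..42}" "l \<in> {1..42}" "i \<noteq> l" for i l
    using dim_KTGS_sector_Int[OF that(1,2)] web_index_inter_card_less[OF that]
    by (intro empty_interior_lowdim) simp
  then show ?thesis
    unfolding sector_decomposition_def
    using full_KTGS_completion sector_KTGS_sector full_KTGS_sector KTGS_sector_subset UN_KTGS_sector
    by auto
qed

lemma card_walls:
  assumes i: "i \<in> {1..42}"
  shows "card {KTGS_sector i \<inter> KTGS_sector l | l.
    l \<in> {1..42} \<and> intersect_in_wall (KTGS_sector i) (KTGS_sector l)} = 4"
proof -
  \<comment> \<open>\<open>F j\<close> is the facet of the sector opposite to
    \<open>web_vec j\<close>; the walls turn out to be these four facets.\<close>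
  define F where "F j = nonneg_span (web_vec ` ({1..8} \<union> (web_index i - {j})))" for j
  have sub: "{1..8} \<union> (web_index i - {j}) \<subseteq> web_indices i" for j
    by (auto simp: web_indices_def)
  have card4: "card (web_index i) = 4"
    by (rule web_index_props(2)[OF i])
  have "{KTGS_sector i \<inter> KTGS_sector l | l.
      l \<in> {1..42} \<and> intersect_in_wall (KTGS_sector i) (KTGS_sector l)} = F ` web_index i" (is "?W = _")
  proof (intro equalityI subsetI)
    fix w assume "w \<in> ?W"
    then obtain l where l: "l \<in> {1..42}" "w = KTGS_sector i \<inter> KTGS_sector l"
        "card (web_index i \<inter> web_index l) = 3"
      using intersect_in_wall_iff[OF i] by blast
    have "card (web_index i - web_index l) = 1"
      using card_Diff_subset_Int[of "web_index i" "web_index l"] web_index_finite[OF i] l(3) card4 by simp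
    then obtain j where j: "web_index i - web_index l = {j}"
      by (auto simp: card_1_singleton_iff)
    then have "web_index i \<inter> web_index l = web_index i - {j}"
      by blast
    then have "w = F j"
      unfolding l(2) KTGS_sector_Int[OF i l(1)] F_def by simp
    then show "w \<in> F ` web_index i"
      using j by blast
  next
    fix w assume "w \<in> F ` web_index i"
    then obtain j where j: "j \<in> web_index i" "w = F j"
      by blast
    obtain l where l: "l \<in> {1..42}" "web_index i \<inter> web_index l = web_index i - {j}"
      using ex1_web_index_neighbour[OF i j(1)] by (elim ex1E conjE)
    have "card (web_index i \<inter> web_index l) = 3"
      unfolding l(2) using j(1) card4 by simp
    then have "intersect_in_wall (KTGS_sector i) (KTGS_sector l)"
      using intersect_in_wall_iff[OF i l(1)] by simp
    moreover have "w = KTGS_sector i \<inter> KTGS_sector l"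
      unfolding j(2) F_def KTGS_sector_Int[OF i l(1)] l(2) ..
    ultimately show "w \<in> ?W"
      using l(1) by blast
  qed
  \<comment> \<open>If \<open>F j = F k\<close> with j and k distinct, this cone is also the
    intersection of the two facets, which omits both generators and has dimension 10 instead of
    11.\<close>
  moreover have "inj_on F (web_index i)"
  proof (rule inj_onI, rule ccontr)
    fix j k assume jk: "j \<in> web_index i" "k \<in> web_index i" "F j = F k" "j \<noteq> k"
    have "({1..8} \<union> (web_index i - {j})) \<inter> ({1..8} \<union> (web_index i - {k})) = {1..8} \<union> (web_index i - {j, k})"
      by blast
    then have "F j = nonneg_span (web_vec ` ({1..8} \<union> (web_index i - {j, k})))"
      using nonneg_span_web_vec_Int[OF i sub[of j] i sub[of k]] jk(3) by (simp add: F_def)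
    moreover have "{1..8} \<union> (web_index i - {j, k}) \<subseteq> web_indices i"
      by (auto simp: web_indices_def)
    ultimately have "card ({1..8} \<union> (web_index i - {j})) = card ({1..8} \<union> (web_index i - {j, k}))"
      using dim_nonneg_span_web_vec[OF i] sub[of j] unfolding F_def by metis
    then have "card (web_index i - {j}) = card (web_index i - {j, k})"
      using card_web_indices_Int[OF i, of "web_index i - {j}"]
        card_web_indices_Int[OF i, of "web_index i - {j, k}"] by auto
    then show False
      using jk card4 web_index_finite[OF i] by (simp add: card_Diff_subset)
  qed
  ultimately show ?thesis
    using card4 by (simp add: card_image)
qed

theorem theorem4p8:
  shows
    "dim KTGS_completion = 12 \<and> full_cone KTGS_completion \<and>
     sector_decomposition {1..42} KTGS_sector KTGS_completion \<and>
     (\<forall>i\<in>{1..42}. \<forall>l\<in>{1..42}.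
       intersect_in_wall (KTGS_sector i) (KTGS_sector l)
         \<longleftrightarrow> card (web_index i \<inter> web_index l) = 3) \<and>
     (\<forall>i\<in>{1..42}. \<forall>l\<in>{1..42}.
       card (web_index i \<inter> web_index l) = 3 \<longrightarrow>
       KTGS_sector i \<inter> KTGS_sector l
         = nonneg_span (web_vec ` ({1..8} \<union> (web_index i \<inter> web_index l)))) \<and>
     (\<forall>i\<in>{1..42}. \<forall>j\<in>web_index i.
       \<exists>!k. k \<in> {1..42} \<and> web_index i \<inter> web_index k = web_index i - {j}) \<and>
     (\<forall>i\<in>{1..42}. \<forall>j\<in>web_index i. \<forall>k\<in>{1..42}.
       web_index i \<inter> web_index k = web_index i - {j} \<longrightarrow>
       (\<exists>j'. j' \<noteq> j \<and> j' \<notin> web_index i \<and> web_index k = insert j' (web_index i - {j}))) \<and>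
     (\<forall>i\<in>{1..42}.
       card {KTGS_sector i \<inter> KTGS_sector l | l.
               l \<in> {1..42} \<and> intersect_in_wall (KTGS_sector i) (KTGS_sector l)} = 4)"
proof (intro conjI ballI impI)
  show "dim KTGS_completion = 12" "full_cone KTGS_completion"
    "sector_decomposition {1..42} KTGS_sector KTGS_completion"
    by (fact dim_KTGS_completion full_KTGS_completion sector_decomposition_KTGS)+
qed (simp_all only: intersect_in_wall_iff KTGS_sector_Int ex1_web_index_neighbour web_index_exchange card_walls)

end
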